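(* Any finite simple graph $A$ and its Barycentric refined graph $A_1$ are homotopic.
   Context: The Barycentric refinement $A_1$ of a graph $A$ is the graph whose vertices are the simplices (non-empty complete subgraphs) of $A$, two distinct simplices being adjacent iff one is contained in the other. For a vertex $x$ of a finite simple graph, the unit sphere $S(x)$ is the subgraph induced by the neighbors of $x$. Contractible graphs are defined recursively: the one-point graph $K_1$ is contractible; a graph $B$ is contractible if there is a vertex $v$ such that both $S(v)$ and $B-v$ (the graph induced by the vertices other than $v$) are contractible. A homotopy step is either removing a vertex $v$ (with its edges) for which $S(v)$ is contractible, or the reverse: choosing a contractible (induced) subgraph $C$ of a graph and adding a new vertex $v$ connected exactly to all vertices of $C$. Two finite simple graphs are homotopic if one is obtained from the other, up to isomorphism, by finitely many homotopy steps. *)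

theory Defs
  imports "Graph_Theory.Graph_Theory"
begin

text \<open>
  Finite simple graphs are the \<^locale>\<open>graph\<close>s of the library: finite symmetric digraphs without
  loops and without parallel arcs, an undirected edge being a pair of opposite arcs.
\<close>

definition unit_sphere :: "('a, 'b) pre_digraph \<Rightarrow> 'a \<Rightarrow> ('a, 'b) pre_digraph" where
  "unit_sphere G x = G \<restriction> {y. x \<rightarrow>\<^bsub>G\<^esub> y}"

inductive contractible_graph :: "('a, 'b) pre_digraph \<Rightarrow> bool" where
  one_point: "complete_digraph 1 G \<Longrightarrow> contractible_graph G"
| vertex_deletion:
    "\<lbrakk>graph G; v \<in> verts G; contractible_graph (unit_sphere G v);
      contractible_graph (pre_digraph.del_vert G v)\<rbrakk> \<Longrightarrow> contractible_graph G"

text \<open>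
  In rule \<open>delete\<close> the equation determines \<open>H\<close>, because \<^const>\<open>with_proj\<close> is injective.
  The set \<open>C\<close> in rule \<open>attach\<close> is the vertex set of the contractible induced subgraph.
\<close>

inductive homotopy_step :: "'a pair_pre_digraph \<Rightarrow> 'a pair_pre_digraph \<Rightarrow> bool" where
  delete:
    "\<lbrakk>pair_graph G; v \<in> pverts G; contractible_graph (unit_sphere (with_proj G) v);
      with_proj H = pre_digraph.del_vert (with_proj G) v\<rbrakk> \<Longrightarrow> homotopy_step G H"
| attach:
    "\<lbrakk>pair_graph G; C \<subseteq> pverts G; contractible_graph (with_proj G \<restriction> C); v \<notin> pverts G;
      H = \<lparr>pverts = insert v (pverts G), parcs = parcs G \<union> {v} \<times> C \<union> C \<times> {v}\<rparr>\<rbrakk>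
      \<Longrightarrow> homotopy_step G H"

text \<open>
  The two graphs may have different vertex types, and their own vertex types may be too small
  to contain a fresh vertex. The steps are therefore performed on isomorphic copies with vertices
  in \<^typ>\<open>nat\<close>: every finite simple graph has such a copy, and a fresh vertex is always available.
\<close>

definition homotopic_graphs :: "('a, 'b) pre_digraph \<Rightarrow> ('c, 'd) pre_digraph \<Rightarrow> bool" where
  "homotopic_graphs G H \<longleftrightarrow> (\<exists>G' H' :: nat pair_pre_digraph.
     digraph_iso G (with_proj G') \<and> digraph_iso H (with_proj H') \<and> homotopy_step\<^sup>*\<^sup>* G' H')"

definition simplices :: "('a, 'b) pre_digraph \<Rightarrow> 'a set set" where
  "simplices G = {s. s \<noteq> {} \<and> s \<subseteq> verts G \<and> complete_digraph (card s) (G \<restriction> s)}"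

definition barycentric_refinement :: "('a, 'b) pre_digraph \<Rightarrow> 'a set pair_pre_digraph" where
  "barycentric_refinement G =
     \<lparr>pverts = simplices G,
      parcs = {(s, t). s \<in> simplices G \<and> t \<in> simplices G \<and> (s \<subset> t \<or> t \<subset> s)}\<rparr>"

end

theory Submission
  imports Defs
begin

text \<open>
  The idea is to pass through a graph that contains \<open>A\<close> and \<open>A\<^sub>1\<close> side by side: its vertices
  are the vertices and the simplices of \<open>A\<close>, it induces \<open>A\<close> on the former and \<open>A\<^sub>1\<close> on
  the latter, and a vertex \<open>v\<close> is joined to a simplex \<open>s\<close> iff \<open>v \<in> s\<close>.

  This graph arises from \<open>A\<close> by attaching the simplices in an order in which a simplex comes
  after all simplices that properly contain it. When \<open>s\<close> is attached, its neighbors are the elements of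
  \<open>s\<close> and the simplices that properly contain \<open>s\<close>, and an element of \<open>s\<close> is
  adjacent to all the others among these. So the neighbors span a cone, and cones are contractible
  (\<open>contractible_on_cone\<close>).

  It is reduced to \<open>A\<^sub>1\<close> by deleting the vertices of \<open>A\<close> in any order. If \<open>R\<close> is
  the set of vertices that remain besides \<open>v\<close>, then the unit sphere of \<open>v\<close> consists of
  the neighbors of \<open>v\<close> in \<open>R\<close> and the simplices that contain \<open>v\<close>. To see by
  induction that it is contractible one replaces \<open>{v}\<close> by an arbitrary simplex
  (\<open>contractible_on_link_star\<close>).
\<close>

section \<open>Contractibility of vertex sets\<close>

text \<open>
  For one adjacency relation \<open>E\<close> every graph below is induced by a set of vertices. Working
  with these sets, and with \<open>E\<close> on the natural vertex type, keeps the labels in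
  \<^typ>\<open>nat\<close> out of the combinatorial argument.
\<close>

inductive contractible_on :: "('a \<Rightarrow> 'a \<Rightarrow> bool) \<Rightarrow> 'a set \<Rightarrow> bool" for E where
  point: "contractible_on E {v}"
| deletion: "\<lbrakk>v \<in> U; contractible_on E {y \<in> U. E v y}; contractible_on E (U - {v})\<rbrakk>
    \<Longrightarrow> contractible_on E U"

lemma contractible_on_finite: "contractible_on E U \<Longrightarrow> finite U"
  by (induction rule: contractible_on.induct) auto

text \<open>
  Any vertex of the base can be deleted: both its sphere and what remains are again cones with the
  same apex, over smaller bases.
\<close>

lemma contractible_on_cone:
  assumes "finite U" "irreflp E" "\<And>u. u \<in> U \<Longrightarrow> E u a" "a \<notin> U"
  shows "contractible_on E (insert a U)"
  using assms(1,3,4)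
proof (induction U rule: finite_psubset_induct)
  case (psubset U)
  show ?case
  proof (cases "U = {}")
    case True
    then show ?thesis by (simp add: contractible_on.point)
  next
    case False
    then obtain w where w: "w \<in> U" by blast
    have "\<not> E w w" using \<open>irreflp E\<close> by (simp add: irreflp_def)
    then have "{y \<in> U. E w y} \<subset> U" using w by blast
    then have "contractible_on E (insert a {y \<in> U. E w y})"
      using psubset.prems by (intro psubset.IH) auto
    moreover have "{y \<in> insert a U. E w y} = insert a {y \<in> U. E w y}"
      using psubset.prems(1)[OF w] by auto
    moreover have "contractible_on E (insert a (U - {w}))"
      using psubset.prems w by (intro psubset.IH) auto
    moreover have "insert a U - {w} = insert a (U - {w})"
      using w psubset.prems(2) by auto
    ultimately show ?thesis
      using w by - (rule contractible_on.deletion[of w], auto)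
  qed
qed

section \<open>Relabelled induced graphs\<close>

text \<open>
  The labelling \<open>e\<close> produces the copies with vertices in \<^typ>\<open>nat\<close> between which the
  homotopy steps take place. As it is the same for all vertex sets, a step between two copies is
  the deletion or the addition of one element of \<open>U\<close>.
\<close>

definition relabelled_graph ::
    "('a \<Rightarrow> 'b) \<Rightarrow> ('a \<Rightarrow> 'a \<Rightarrow> bool) \<Rightarrow> 'a set \<Rightarrow> 'b pair_pre_digraph" where
  "relabelled_graph e E U =
     \<lparr>pverts = e ` U, parcs = (\<lambda>(x, y). (e x, e y)) ` {(x, y). x \<in> U \<and> y \<in> U \<and> E x y}\<rparr>"

lemma pverts_relabelled_graph [simp]: "pverts (relabelled_graph e E U) = e ` U"
  by (simp add: relabelled_graph_def)

lemma parcs_relabelled_graph: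
  "parcs (relabelled_graph e E U) = {(e x, e y) | x y. x \<in> U \<and> y \<in> U \<and> E x y}"
  by (auto simp: relabelled_graph_def)

lemma pair_graph_relabelled_graph:
  assumes "finite U" "inj_on e U" "symp E" "irreflp E"
  shows "pair_graph (relabelled_graph e E U)"
proof
  have "parcs (relabelled_graph e E U) \<subseteq> e ` U \<times> e ` U"
    by (auto simp: parcs_relabelled_graph)
  then show "finite (parcs (relabelled_graph e E U))"
    by (rule finite_subset) (use assms(1) in auto)
  show "symmetric (with_proj (relabelled_graph e E U))"
    using assms(3) by (auto simp: symmetric_def sym_def parcs_relabelled_graph dest: sympD)
  show "fst a \<noteq> snd a" if "a \<in> parcs (relabelled_graph e E U)" for a
    using that assms(2,4) by (auto simp: parcs_relabelled_graph irreflp_def inj_on_eq_iff)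
qed (use assms(1) in \<open>auto simp: parcs_relabelled_graph\<close>)

lemma induce_relabelled_graph:
  assumes "inj_on e U" "W \<subseteq> U"
  shows "with_proj (relabelled_graph e E U) \<restriction> (e ` W) = with_proj (relabelled_graph e E W)"
proof -
  have mem: "e x \<in> e ` W \<longleftrightarrow> x \<in> W" if "x \<in> U" for x
    using that assms by (auto dest: inj_onD)
  have "{a \<in> parcs (relabelled_graph e E U). fst a \<in> e ` W \<and> snd a \<in> e ` W}
      = parcs (relabelled_graph e E W)" (is "?L = ?R")
  proof
    show "?L \<subseteq> ?R"
    proof
      fix a assume a: "a \<in> ?L"
      then obtain x y where "a = (e x, e y)" "x \<in> U" "y \<in> U" "E x y"
        by (auto simp: parcs_relabelled_graph)
      with a mem[of x] mem[of y] show "a \<in> ?R"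
        unfolding parcs_relabelled_graph by auto
    qed
    show "?R \<subseteq> ?L" using assms(2) by (auto simp: parcs_relabelled_graph)
  qed
  then show ?thesis
    by (simp add: induce_subgraph_def with_proj_def)
qed

lemma unit_sphere_relabelled_graph:
  assumes "inj_on e U" "v \<in> U"
  shows "unit_sphere (with_proj (relabelled_graph e E U)) (e v)
    = with_proj (relabelled_graph e E {y \<in> U. E v y})"
proof -
  have "{y. e v \<rightarrow>\<^bsub>with_proj (relabelled_graph e E U)\<^esub> y} = e ` {y \<in> U. E v y}"
    using assms by (auto simp: parcs_relabelled_graph dest: inj_onD)
  then show ?thesis
    unfolding unit_sphere_def using assms(1) by (simp add: induce_relabelled_graph)
qed

lemma del_vert_relabelled_graph:
  assumes "inj_on e U" "v \<in> U"
  shows "pre_digraph.del_vert (with_proj (relabelled_graph e E U)) (e v)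
    = with_proj (relabelled_graph e E (U - {v}))"
proof -
  have vs: "e ` (U - {v}) = e ` U - {e v}"
    using assms by (auto dest: inj_onD)
  have "with_proj (relabelled_graph e E (U - {v}))
    = with_proj (relabelled_graph e E U) \<restriction> (e ` U - {e v})"
    using induce_relabelled_graph[OF assms(1), of "U - {v}" E] vs by simp
  also have "\<dots> = pre_digraph.del_vert (with_proj (relabelled_graph e E U)) (e v)"
    by (auto simp: induce_subgraph_def pre_digraph.del_vert_def parcs_relabelled_graph)
  finally show ?thesis by simp
qed

lemma contractible_graph_relabelled_graph:
  assumes "contractible_on E U" "inj_on e U" "symp E" "irreflp E"
  shows "contractible_graph (with_proj (relabelled_graph e E U))"
  using assms(1,2)
proof (induction rule: contractible_on.induct)
  case (point v)
  have "complete_digraph 1 (with_proj (relabelled_graph e E {v}))"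
    using assms(4)
    by (auto simp: complete_digraph_pair_def parcs_relabelled_graph irreflp_def)
  then show ?case by (rule contractible_graph.one_point)
next
  case (deletion v U)
  have "finite U"
    using contractible_on_finite[OF deletion.hyps(3)] by simp
  then have "pair_graph (relabelled_graph e E U)"
    using deletion.prems assms(3,4) by (intro pair_graph_relabelled_graph)
  moreover have "inj_on e {y \<in> U. E v y}" "inj_on e (U - {v})"
    using deletion.prems by (auto simp: inj_on_def)
  ultimately show ?case
    using deletion.IH deletion.hyps(1) deletion.prems
    by - (rule contractible_graph.vertex_deletion[where v = "e v"],
      simp_all add: unit_sphere_relabelled_graph del_vert_relabelled_graph
        pair_graph.pair_graphD_graph)
qed

lemma homotopy_step_delete:
  assumes "finite U" "v \<in> U" "contractible_on E {y \<in> U. E v y}"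
    "inj_on e U" "symp E" "irreflp E"
  shows "homotopy_step (relabelled_graph e E U) (relabelled_graph e E (U - {v}))"
proof (rule homotopy_step.delete)
  show "pair_graph (relabelled_graph e E U)"
    using assms by (intro pair_graph_relabelled_graph)
  have "inj_on e {y \<in> U. E v y}" using assms(4) by (rule inj_on_subset) auto
  then show "contractible_graph (unit_sphere (with_proj (relabelled_graph e E U)) (e v))"
    using assms
    by (simp add: unit_sphere_relabelled_graph contractible_graph_relabelled_graph)
qed (use assms in \<open>auto simp: del_vert_relabelled_graph\<close>)

lemma homotopy_step_attach:
  assumes "finite U" "v \<notin> U" "contractible_on E {y \<in> U. E v y}"
    "inj_on e (insert v U)" "symp E" "irreflp E"
  shows "homotopy_step (relabelled_graph e E U) (relabelled_graph e E (insert v U))"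
proof (rule homotopy_step.attach)
  have inj: "inj_on e U" using assms(4) by (rule inj_on_subset) auto
  show "pair_graph (relabelled_graph e E U)"
    using assms inj by (intro pair_graph_relabelled_graph)
  show "contractible_graph (with_proj (relabelled_graph e E U) \<restriction> (e ` {y \<in> U. E v y}))"
    using assms inj inj_on_subset[OF inj, of "{y \<in> U. E v y}"]
    by (subst induce_relabelled_graph)
      (auto simp: contractible_graph_relabelled_graph)
  show "e v \<notin> pverts (relabelled_graph e E U)"
    using assms(2,4) by auto
  have "\<not> E v v" using assms(6) by (simp add: irreflp_def)
  then have "parcs (relabelled_graph e E (insert v U)) =
    parcs (relabelled_graph e E U) \<union> {e v} \<times> e ` {y \<in> U. E v y} \<union> e ` {y \<in> U. E v y} \<times> {e v}"
    using assms(5) by (auto simp: parcs_relabelled_graph dest: sympD)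
  then show "relabelled_graph e E (insert v U) =
    \<lparr>pverts = insert (e v) (pverts (relabelled_graph e E U)),
     parcs = parcs (relabelled_graph e E U) \<union> {e v} \<times> e ` {y \<in> U. E v y}
       \<union> e ` {y \<in> U. E v y} \<times> {e v}\<rparr>"
    by (intro pair_pre_digraph.equality) auto
qed auto

text \<open>
  Since parallel arcs are excluded, a bijection on vertices that respects adjacency determines the
  bijection on arcs.
\<close>

lemma digraph_iso_relabelled_graph:
  assumes "graph G" "inj_on f (verts G)" "e ` U = f ` verts G"
    "parcs (relabelled_graph e E U) = (\<lambda>(x, y). (f x, f y)) ` arcs_ends G"
  shows "digraph_iso G (with_proj (relabelled_graph e E U))"
proof -
  interpret graph G by fact
  let ?h = "\<lparr>iso_verts = f, iso_arcs = \<lambda>a. (f (tail G a), f (head G a)),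
    iso_head = snd, iso_tail = fst\<rparr>"
  have "inj_on (\<lambda>a. (f (tail G a), f (head G a))) (arcs G)"
  proof (rule inj_onI)
    fix a b assume ab: "a \<in> arcs G" "b \<in> arcs G"
      "(f (tail G a), f (head G a)) = (f (tail G b), f (head G b))"
    then have "tail G a = tail G b" "head G a = head G b"
      using assms(2) by (auto dest: inj_onD)
    with ab show "a = b" using no_multi_arcs by (simp add: arc_to_ends_def)
  qed
  then have "digraph_isomorphism ?h"
    using assms(2) by (simp add: digraph_isomorphism_def wf_digraph)
  moreover have "with_proj (relabelled_graph e E U) = app_iso ?h G"
    using assms(3,4)
    by (auto simp: app_iso_def with_proj_def arcs_ends_conv image_image)
  ultimately show ?thesis unfolding digraph_iso_def by blast
qed

section \<open>The graph of vertices and simplices\<close>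

definition cliques :: "('a \<Rightarrow> 'a \<Rightarrow> bool) \<Rightarrow> 'a set \<Rightarrow> 'a set set" where
  "cliques R V = {s. s \<noteq> {} \<and> s \<subseteq> V \<and> pairwise R s}"

fun incidence :: "('a \<Rightarrow> 'a \<Rightarrow> bool) \<Rightarrow> 'a + 'a set \<Rightarrow> 'a + 'a set \<Rightarrow> bool" where
  "incidence R (Inl v) (Inl w) \<longleftrightarrow> R v w"
| "incidence R (Inl v) (Inr s) \<longleftrightarrow> v \<in> s"
| "incidence R (Inr s) (Inl v) \<longleftrightarrow> v \<in> s"
| "incidence R (Inr s) (Inr t) \<longleftrightarrow> s \<subset> t \<or> t \<subset> s"

lemma finite_cliques: "finite V \<Longrightarrow> finite (cliques R V)"
  by (rule finite_subset[of _ "Pow V"]) (auto simp: cliques_def)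

lemma symp_incidence:
  assumes "symp R"
  shows "symp (incidence R)"
proof (rule sympI)
  fix x y assume "incidence R x y"
  then show "incidence R y x"
    using assms by (cases x; cases y) (auto dest: sympD)
qed

lemma irreflp_incidence:
  assumes "irreflp R"
  shows "irreflp (incidence R)"
proof (rule irreflpI)
  fix x show "\<not> incidence R x x"
    using assms by (cases x) (auto simp: irreflp_def)
qed

text \<open>
  The set consists of the vertices of \<open>W\<close> in the link of the simplex \<open>\<sigma>\<close>, and of the
  simplices that contain \<open>\<sigma>\<close>. For such a vertex \<open>w\<close>, the sphere of \<open>w\<close> within the
  set is the set of the same kind that belongs to the larger simplex \<open>insert w \<sigma>\<close>. Hence the
  vertices can be deleted one by one; when none is left, \<open>\<sigma>\<close> itself is the apex of a cone.
\<close>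

lemma contractible_on_link_star:
  assumes "finite V" "symp R" "irreflp R" "W \<subseteq> V" "\<sigma> \<in> cliques R V"
  shows "contractible_on (incidence R)
    (Inl ` {w \<in> W. \<forall>v\<in>\<sigma>. R v w} \<union> Inr ` {s \<in> cliques R V. \<sigma> \<subseteq> s})"
proof -
  have "finite W" using assms(1,4) by (rule finite_subset[rotated])
  then show ?thesis
    using assms(4,5)
  proof (induction W arbitrary: \<sigma> rule: finite_psubset_induct)
    case (psubset W)
    let ?U = "\<lambda>W \<sigma>. Inl ` {w \<in> W. \<forall>v\<in>\<sigma>. R v w} \<union> Inr ` {s \<in> cliques R V. \<sigma> \<subseteq> s}"
    show ?case
    proof (cases "{w \<in> W. \<forall>v\<in>\<sigma>. R v w} = {}")
      case True
      have "contractible_on (incidence R) (insert (Inr \<sigma>) (Inr ` {s \<in> cliques R V. \<sigma> \<subset> s}))"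
        using finite_cliques[OF assms(1)] irreflp_incidence[OF assms(3)]
        by (intro contractible_on_cone) auto
      moreover have "?U W \<sigma> = insert (Inr \<sigma>) (Inr ` {s \<in> cliques R V. \<sigma> \<subset> s})"
        unfolding True using psubset.prems(2) by auto
      ultimately show ?thesis by simp
    next
      case False
      then obtain w where w: "w \<in> W" "\<forall>v\<in>\<sigma>. R v w" by blast
      have "insert w \<sigma> \<in> cliques R V"
        using w psubset.prems assms(2)
        by (auto simp: cliques_def pairwise_insert dest: sympD)
      then have "contractible_on (incidence R) (?U (W - {w}) (insert w \<sigma>))"
        using w psubset.prems by (intro psubset.IH) auto
      moreover have "\<not> R w w" using assms(3) by (simp add: irreflp_def)
      then have "{y \<in> ?U W \<sigma>. incidence R (Inl w) y} = ?U (W - {w}) (insert w \<sigma>)"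
        by auto
      moreover have "contractible_on (incidence R) (?U (W - {w}) \<sigma>)"
        using w psubset.prems by (intro psubset.IH) auto
      moreover have "?U W \<sigma> - {Inl w} = ?U (W - {w}) \<sigma>"
        by auto
      ultimately show ?thesis
        using w by - (rule contractible_on.deletion[of "Inl w"], auto)
    qed
  qed
qed

text \<open>
  The set \<open>T\<close> is closed under taking larger simplices, so that it can be built up by adding an
  inclusion-minimal element last.
\<close>

lemma homotopy_steps_attach_simplices:
  assumes "finite V" "symp R" "irreflp R" "inj_on e (V <+> cliques R V)"
    and "T \<subseteq> cliques R V" "\<And>s t. \<lbrakk>s \<in> T; t \<in> cliques R V; s \<subseteq> t\<rbrakk> \<Longrightarrow> t \<in> T"
  shows "homotopy_step\<^sup>*\<^sup>* (relabelled_graph e (incidence R) (Inl ` V))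
    (relabelled_graph e (incidence R) (V <+> T))"
proof -
  have "finite T" using finite_cliques[OF assms(1)] assms(5) by (rule finite_subset[rotated])
  then show ?thesis
    using assms(5,6)
  proof (induction T rule: finite_psubset_induct)
    case (psubset T)
    show ?case
    proof (cases "T = {}")
      case True
      then show ?thesis by (simp add: Plus_def)
    next
      case False
      then obtain s where s: "s \<in> T" and min: "\<And>t. t \<in> T \<Longrightarrow> t \<subseteq> s \<Longrightarrow> t = s"
        using finite_has_minimal[OF psubset.hyps] by metis
      from s psubset.prems(1) have "s \<noteq> {}" "s \<subseteq> V" "pairwise R s"
        by (auto simp: cliques_def)
      then obtain v where v: "v \<in> s" "v \<in> V" by blast
      have adj: "R u v" if "u \<in> s" "u \<noteq> v" for u
        using pairwiseD(1)[OF \<open>pairwise R s\<close> that(1) v(1)] that(2) by blast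
      \<comment> \<open>By minimality no proper subset of \<open>s\<close> has been attached yet; any element of
        \<open>s\<close> is then an apex of the sphere of \<open>s\<close>.\<close>
      let ?U = "Inl ` (s - {v}) \<union> Inr ` {t \<in> T. s \<subset> t}"
      have "contractible_on (incidence R) (insert (Inl v) ?U)"
        using \<open>finite T\<close> finite_subset[OF \<open>s \<subseteq> V\<close> assms(1)] v irreflp_incidence[OF assms(3)]
        by (intro contractible_on_cone) (auto intro: adj)
      moreover have "\<forall>t\<in>T. \<not> t \<subset> s" using min by blast
      then have "{y \<in> V <+> (T - {s}). incidence R (Inr s) y} = insert (Inl v) ?U"
        using \<open>s \<subseteq> V\<close> v by auto
      moreover have "insert (Inr s) (V <+> (T - {s})) = V <+> T"
        using s by auto
      moreover have "inj_on e (V <+> T)"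
        using assms(4) by (rule inj_on_subset) (use psubset.prems in auto)
      ultimately have "homotopy_step (relabelled_graph e (incidence R) (V <+> (T - {s})))
          (relabelled_graph e (incidence R) (V <+> T))"
        using homotopy_step_attach[of "V <+> (T - {s})" "Inr s" "incidence R" e]
          symp_incidence[OF assms(2)] irreflp_incidence[OF assms(3)] assms(1) \<open>finite T\<close>
        by auto
      moreover have "homotopy_step\<^sup>*\<^sup>* (relabelled_graph e (incidence R) (Inl ` V))
          (relabelled_graph e (incidence R) (V <+> (T - {s})))"
        using s psubset.prems min by (intro psubset.IH) auto
      ultimately show ?thesis by simp
    qed
  qed
qed

text \<open>
  At each deletion the sphere of \<open>v\<close> is the set in \<open>contractible_on_link_star\<close> for
  the one-element simplex \<open>{v}\<close>.
\<close>

lemma homotopy_steps_delete_vertices: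
  assumes "finite V" "symp R" "irreflp R" "inj_on e (V <+> cliques R V)" "W \<subseteq> V"
  shows "homotopy_step\<^sup>*\<^sup>* (relabelled_graph e (incidence R) (W <+> cliques R V))
    (relabelled_graph e (incidence R) (Inr ` cliques R V))"
proof -
  have "finite W" using assms(1,5) by (rule finite_subset[rotated])
  then show ?thesis
    using assms(5)
  proof (induction W rule: finite_induct)
    case empty
    then show ?case by (simp add: Plus_def)
  next
    case (insert v W)
    let ?U = "insert v W <+> cliques R V"
    have "\<not> R v v" using assms(3) by (simp add: irreflp_def)
    then have "{y \<in> ?U. incidence R (Inl v) y}
      = Inl ` {w \<in> W. \<forall>u\<in>{v}. R u w} \<union> Inr ` {s \<in> cliques R V. {v} \<subseteq> s}"
      by auto
    moreover have "{v} \<in> cliques R V" using insert.prems by (simp add: cliques_def)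
    ultimately have "contractible_on (incidence R) {y \<in> ?U. incidence R (Inl v) y}"
      using contractible_on_link_star[OF assms(1-3), of W "{v}"] insert.prems by simp
    moreover have "inj_on e ?U"
      using assms(4) by (rule inj_on_subset) (use insert.prems in auto)
    moreover have "?U - {Inl v} = W <+> cliques R V"
      using insert.hyps by auto
    ultimately have "homotopy_step (relabelled_graph e (incidence R) ?U)
        (relabelled_graph e (incidence R) (W <+> cliques R V))"
      using homotopy_step_delete[of ?U "Inl v" "incidence R" e] insert.hyps
        symp_incidence[OF assms(2)] irreflp_incidence[OF assms(3)] finite_cliques[OF assms(1)]
      by auto
    then show ?case
      using insert by (auto intro: converse_rtranclp_into_rtranclp)
  qed
qed

section \<open>Homotopy of a graph and its Barycentric refinement\<close>

lemma (in graph) simplices_eq_cliques: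
  "simplices G = cliques (\<lambda>x y. x \<rightarrow>\<^bsub>G\<^esub> y) (verts G)"
proof -
  have "complete_digraph (card s) (G \<restriction> s) \<longleftrightarrow> pairwise (\<lambda>x y. x \<rightarrow>\<^bsub>G\<^esub> y) s"
    if s: "s \<subseteq> verts G" for s
  proof -
    have "graph (G \<restriction> s)"
    proof
      show "finite (verts (G \<restriction> s))" using s finite_verts by (auto intro: finite_subset)
      show "symmetric (G \<restriction> s)" using sym_arcs by (fastforce simp: symmetric_conv)
    qed (use no_loops no_multi_arcs in \<open>auto simp: arc_to_ends_def\<close>)
    moreover have "arcs_ends (G \<restriction> s) = {(x, y). x \<rightarrow>\<^bsub>G\<^esub> y \<and> x \<in> s \<and> y \<in> s}"
      by (auto simp: arcs_ends_conv)
    ultimately show ?thesis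
      using adj_not_same unfolding complete_digraph_def pairwise_def set_eq_iff by auto
  qed
  then show ?thesis by (auto simp: simplices_def cliques_def)
qed

theorem corollary6:
  fixes A :: "('a, 'b) pre_digraph"
  assumes "graph A"
  shows "homotopic_graphs A (with_proj (barycentric_refinement A))"
proof -
  interpret graph A by fact
  let ?R = "\<lambda>x y. x \<rightarrow>\<^bsub>A\<^esub> y"
  let ?B = "barycentric_refinement A"
  let ?X = "verts A <+> cliques ?R (verts A)"
  have fin: "finite (cliques ?R (verts A))" by (rule finite_cliques) simp
  then obtain e :: "'a + 'a set \<Rightarrow> nat" where e: "inj_on e ?X"
    using finite_imp_inj_to_nat_seg[of ?X] by auto
  let ?H = "relabelled_graph e (incidence ?R)"
  have "symp ?R" using sym_arcs by (auto simp: symmetric_def sym_def symp_def)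
  have "irreflp ?R" using adj_not_same by (auto simp: irreflp_def)
  have "homotopy_step\<^sup>*\<^sup>* (?H (Inl ` verts A)) (?H ?X)"
    using \<open>symp ?R\<close> \<open>irreflp ?R\<close> e by (intro homotopy_steps_attach_simplices) auto
  also have "homotopy_step\<^sup>*\<^sup>* (?H ?X) (?H (Inr ` cliques ?R (verts A)))"
    using \<open>symp ?R\<close> \<open>irreflp ?R\<close> e by (intro homotopy_steps_delete_vertices) auto
  finally have "homotopy_step\<^sup>*\<^sup>* (?H (Inl ` verts A)) (?H (Inr ` cliques ?R (verts A)))" .
  moreover have "digraph_iso A (with_proj (?H (Inl ` verts A)))"
  proof (rule digraph_iso_relabelled_graph[where f = "e \<circ> Inl"])
    show "inj_on (e \<circ> Inl) (verts A)"
      by (rule comp_inj_on, simp, rule inj_on_subset[OF e]) auto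
    show "parcs (?H (Inl ` verts A)) = (\<lambda>(x, y). ((e \<circ> Inl) x, (e \<circ> Inl) y)) ` arcs_ends A"
      by (auto simp: parcs_relabelled_graph image_iff split: prod.splits dest: adj_in_verts)
        (metis adj_in_verts incidence.simps(1))
  qed (auto simp: assms image_image)
  moreover have "digraph_iso (with_proj ?B) (with_proj (?H (Inr ` cliques ?R (verts A))))"
  proof (rule digraph_iso_relabelled_graph[where f = "e \<circ> Inr"])
    have eq: "?B = relabelled_graph id (\<lambda>s t. s \<subset> t \<or> t \<subset> s) (cliques ?R (verts A))"
      by (auto simp: barycentric_refinement_def relabelled_graph_def simplices_eq_cliques)
    have "pair_graph ?B"
      unfolding eq using fin
      by (intro pair_graph_relabelled_graph) (auto simp: symp_def irreflp_def)
    then show "graph (with_proj ?B)" by (rule pair_graph.pair_graphD_graph)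
    show "inj_on (e \<circ> Inr) (verts (with_proj ?B))"
      unfolding eq by (rule comp_inj_on, simp, rule inj_on_subset[OF e]) auto
    show "e ` Inr ` cliques ?R (verts A) = (e \<circ> Inr) ` verts (with_proj ?B)"
      by (simp add: eq image_image)
    show "parcs (?H (Inr ` cliques ?R (verts A)))
      = (\<lambda>(x, y). ((e \<circ> Inr) x, (e \<circ> Inr) y)) ` arcs_ends (with_proj ?B)"
      unfolding eq by (fastforce simp: parcs_relabelled_graph)
  qed
  ultimately show ?thesis
    unfolding homotopic_graphs_def by blast
qed

end
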